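(* Let $g\in W_0(\mathbb{R})$ and let $\Lambda\subseteq\mathbb{R}$ be arbitrary. Suppose that $\mathcal{G}(g,(-\Lambda)\times\mathbb{Z})=\{M_kT_{-\lambda}g:k\in\mathbb{Z},\lambda\in\Lambda\}$ spans a dense subspace in $W_0(\mathbb{R})$. Then for every $x\in\mathbb{R}$, $\Lambda+x$ is a uniqueness set for $V^\infty(g)$.
   Context: $W_0(\mathbb{R})=W(C,\ell_1)$ is the space of continuous functions $g:\mathbb{R}\to\mathbb{C}$ with $\|g\|_W=\sum_{k\in\mathbb{Z}}\max_{x\in[k,k+1]}|g(x)|<\infty$, equipped with this norm. $V^\infty(g)=\{\sum_{k\in\mathbb{Z}}c_kg(\cdot-k):c\in\ell^\infty(\mathbb{Z})\}$. A set $\Lambda$ is a uniqueness set for $V^\infty(g)$ if $f\in V^\infty(g)$ and $f(\lambda)=0$ for all $\lambda\in\Lambda$ imply $f=0$. $T_yg(x)=g(x-y)$, $M_\xi g(x)=e^{2\pi ix\xi}g(x)$. *)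

theory Defs
  imports "HOL-Analysis.Analysis" "HOL-Library.Function_Algebras"
begin

text \<open>
  The functions are continuous, so the supremum over \<open>[k, k + 1]\<close> is a maximum.
\<close>

definition local_max :: "(real \<Rightarrow> complex) \<Rightarrow> int \<Rightarrow> real" where
  "local_max g k = (SUP x\<in>{of_int k..of_int k + 1}. norm (g x))"

definition W0 :: "(real \<Rightarrow> complex) set" where
  "W0 = {g. continuous_on UNIV g \<and> local_max g summable_on UNIV}"

text \<open>Only meaningful on \<^const>\<open>W0\<close>: outside it, \<^const>\<open>infsum\<close> may default to \<open>0\<close>.\<close>

definition W_norm :: "(real \<Rightarrow> complex) \<Rightarrow> real" where
  "W_norm g = (\<Sum>\<^sub>\<infinity>k. local_max g k)"

definition dense_in_W0 :: "(real \<Rightarrow> complex) set \<Rightarrow> bool" where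
  "dense_in_W0 S \<longleftrightarrow>
     S \<subseteq> W0 \<and> (\<forall>h\<in>W0. \<forall>\<epsilon>>0. \<exists>f\<in>S. W_norm (\<lambda>x. h x - f x) < \<epsilon>)"

text \<open>
  The series is read pointwise. For \<open>g\<close> in \<^const>\<open>W0\<close> and bounded \<open>c\<close> it converges absolutely
  at every point.
\<close>

definition V_infty :: "(real \<Rightarrow> complex) \<Rightarrow> (real \<Rightarrow> complex) set" where
  "V_infty g = {f. \<exists>c :: int \<Rightarrow> complex. bounded (range c) \<and>
     (\<forall>x. ((\<lambda>k. c k * g (x - of_int k)) has_sum f x) UNIV)}"

definition uniqueness_set :: "real set \<Rightarrow> (real \<Rightarrow> complex) set \<Rightarrow> bool" where
  "uniqueness_set \<Lambda> V \<longleftrightarrow> (\<forall>f\<in>V. (\<forall>l\<in>\<Lambda>. f l = 0) \<longrightarrow> f = (\<lambda>x. 0))"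

definition translation :: "real \<Rightarrow> (real \<Rightarrow> complex) \<Rightarrow> real \<Rightarrow> complex" where
  "translation y g = (\<lambda>x. g (x - y))"

definition modulation :: "real \<Rightarrow> (real \<Rightarrow> complex) \<Rightarrow> real \<Rightarrow> complex" where
  "modulation \<xi> g = (\<lambda>x. exp (2 * of_real pi * \<i> * of_real x * of_real \<xi>) * g x)"

definition gabor_system :: "(real \<Rightarrow> complex) \<Rightarrow> (real \<times> real) set \<Rightarrow> (real \<Rightarrow> complex) set" where
  "gabor_system g S = {modulation \<xi> (translation y g) | y \<xi>. (y, \<xi>) \<in> S}"

text \<open>Spans are taken over the complex numbers, with pointwise operations on functions.\<close>

interpretation complex_fun: vector_space "\<lambda>(c::complex) (f :: real \<Rightarrow> complex) x. c * f x"
  by unfold_locales (auto simp: fun_eq_iff algebra_simps)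

end

theory Submission
  imports Defs
begin

text \<open>
  If \<open>f = (\<Sum>k. c k * g (\<sqdot> - k))\<close> vanishes on \<open>\<Lambda> + x\<close>, then the functional
  \<open>h \<mapsto> (\<Sum>k. c k * h (x - k))\<close> vanishes on the Gabor system, because an integer modulation is
  constant on \<open>x + \<int>\<close> and so contributes only a factor. The functional is bounded on \<open>W0\<close>, since
  each interval \<open>[j, j + 1)\<close> contains exactly one of the points \<open>x - k\<close>; by density it is zero.
  Evaluating it at tent functions centred at \<open>x - m\<close> gives \<open>c m = 0\<close> for all \<open>m\<close>.
\<close>

text \<open>Continuity on the compact interval bounds the set under the supremum; a real
  \<open>SUP\<close> says nothing without such a bound.\<close>

lemma norm_le_local_max:
  assumes "continuous_on UNIV h" "y \<in> {of_int k..of_int k + 1}"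
  shows "norm (h y) \<le> local_max h k"
  unfolding local_max_def
proof (rule cSUP_upper[OF assms(2)])
  have "compact ((\<lambda>x. norm (h x)) ` {of_int k..of_int k + 1})"
    by (intro compact_continuous_image continuous_on_norm continuous_on_subset[OF assms(1)]) auto
  then show "bdd_above ((\<lambda>x. norm (h x)) ` {of_int k..of_int k + 1})"
    by (intro bounded_imp_bdd_above compact_imp_bounded)
qed

lemma local_max_least:
  assumes "\<And>y. y \<in> {of_int k..of_int k + 1} \<Longrightarrow> norm (h y) \<le> B"
  shows "local_max h k \<le> B"
  unfolding local_max_def using assms by (intro cSUP_least) auto

lemma local_max_nonneg: "continuous_on UNIV h \<Longrightarrow> 0 \<le> local_max h k"
  using norm_le_local_max[of h "of_int k" k] by (auto intro: order_trans[OF norm_ge_zero])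

text \<open>Approximation errors must lie in \<open>W0\<close>, since \<open>W_norm\<close> is a
  genuine norm only there.\<close>

lemma W0_diff:
  assumes "h \<in> W0" "f \<in> W0"
  shows "(\<lambda>y. h y - f y) \<in> W0"
proof -
  have cont: "continuous_on UNIV h" "continuous_on UNIV f"
    and summable: "local_max h summable_on UNIV" "local_max f summable_on UNIV"
    using assms by (auto simp: W0_def)
  then have cont_diff: "continuous_on UNIV (\<lambda>y. h y - f y)"
    by (intro continuous_intros)
  have "local_max (\<lambda>y. h y - f y) k \<le> local_max h k + local_max f k" for k
    by (intro local_max_least order_trans[OF norm_triangle_ineq4] add_mono norm_le_local_max cont)
  then have "local_max (\<lambda>y. h y - f y) summable_on UNIV"
    using local_max_nonneg[OF cont_diff]
    by (intro summable_on_comparison_test[OF summable_on_add[OF summable]]) auto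
  with cont_diff show ?thesis
    by (simp add: W0_def)
qed

text \<open>The point \<open>x - k\<close> lies in the unit interval starting at
  \<open>\<lfloor>x\<rfloor> - k\<close>, so the series is dominated termwise by \<open>C\<close>
  times a rearrangement of the series for \<open>W_norm h\<close>.\<close>

lemma W_norm_lattice_bound:
  fixes x :: real and c :: "int \<Rightarrow> complex"
  assumes h: "h \<in> W0" and c: "\<And>k. norm (c k) \<le> C"
    and s: "((\<lambda>k. c k * h (x - of_int k)) has_sum s) UNIV"
  shows "norm s \<le> C * W_norm h"
proof -
  have cont: "continuous_on UNIV h" and summable: "local_max h summable_on UNIV"
    using h by (auto simp: W0_def)
  \<comment> \<open>This reflection is its own inverse.\<close>
  have "bij (\<lambda>k. \<lfloor>x\<rfloor> - k)"
    by (rule o_bij[of "\<lambda>k. \<lfloor>x\<rfloor> - k"]) auto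
  moreover have "(local_max h has_sum W_norm h) UNIV"
    using summable by (simp add: W_norm_def)
  ultimately have "((\<lambda>k. local_max h (\<lfloor>x\<rfloor> - k)) has_sum W_norm h) UNIV"
    by (subst has_sum_reindex_bij_betw)
  then have "((\<lambda>k. C * local_max h (\<lfloor>x\<rfloor> - k)) has_sum (C * W_norm h)) UNIV"
    by (rule has_sum_cmult_right)
  with s show ?thesis
  proof (rule norm_infsum_le)
    fix k :: int
    have "x - of_int k \<in> {of_int (\<lfloor>x\<rfloor> - k)..of_int (\<lfloor>x\<rfloor> - k) + 1}"
      using floor_correct[of x] by simp
    then have "norm (h (x - of_int k)) \<le> local_max h (\<lfloor>x\<rfloor> - k)"
      by (rule norm_le_local_max[OF cont])
    then show "norm (c k * h (x - of_int k)) \<le> C * local_max h (\<lfloor>x\<rfloor> - k)"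
      using c[of k] order_trans[OF norm_ge_zero c[of k]]
      by (simp add: norm_mult mult_mono)
  qed
qed

definition tent :: "real \<Rightarrow> real \<Rightarrow> complex" where
  "tent a y = of_real (max 0 (1 - \<bar>y - a\<bar>))"

lemma tent_in_W0: "tent a \<in> W0"
proof -
  \<comment> \<open>The tent vanishes outside \<open>[a - 1, a + 1]\<close>. The window of indices
    is generous, as only its finiteness matters.\<close>
  have "local_max (tent a) k = 0" if "k \<notin> {\<lfloor>a\<rfloor> - 2..\<lfloor>a\<rfloor> + 2}" for k
  proof -
    have "tent a y = 0" if "y \<in> {of_int k..of_int k + 1}" for y
    proof -
      have "1 \<le> \<bar>y - a\<bar>"
        using that \<open>k \<notin> _\<close> by simp linarith
      then show ?thesis
        by (simp add: tent_def)
    qed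
    then show ?thesis
      by (simp add: local_max_def)
  qed
  then have "finite {k \<in> UNIV. local_max (tent a) k \<noteq> 0}"
    by (blast intro: finite_subset[OF _ finite_atLeastAtMost_int[of "\<lfloor>a\<rfloor> - 2" "\<lfloor>a\<rfloor> + 2"]])
  then have "local_max (tent a) summable_on UNIV"
    by (intro finite_nonzero_values_imp_summable_on) simp
  moreover have "continuous_on UNIV (tent a)"
    unfolding tent_def by (intro continuous_intros)
  ultimately show ?thesis
    by (simp add: W0_def)
qed

lemma tent_int_shift: "tent (x - of_int m) (x - of_int k) = (if k = m then 1 else 0)"
proof (cases "k = m")
  case False
  then have "1 \<le> \<bar>real_of_int m - of_int k\<bar>"
    by linarith
  then show ?thesis
    using False by (simp add: tent_def)
qed (simp add: tent_def)

text \<open>The condition is linear in \<open>f\<close>. Stating it with \<open>has_sum\<close> lets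
  one induction carry both convergence and the value 0.\<close>

lemma span_annihilated:
  fixes c :: "int \<Rightarrow> complex" and x :: real
  assumes gen: "\<And>h. h \<in> S \<Longrightarrow> ((\<lambda>k. c k * h (x - of_int k)) has_sum 0) UNIV"
    and f: "f \<in> complex_fun.span S"
  shows "((\<lambda>k. c k * f (x - of_int k)) has_sum 0) UNIV"
  using f
proof (induction rule: complex_fun.span_induct_alt)
  case base
  then show ?case by (simp add: zero_fun_def)
next
  case (step b p q)
  then show ?case
    using has_sum_add[OF has_sum_cmult_right[OF gen[OF step(1)], of b] step(2)]
    by (simp add: plus_fun_def algebra_simps)
qed

text \<open>For \<open>\<xi> = n\<close>, moving from \<open>x\<close> to \<open>x - k\<close>
  changes the exponent by \<open>-2 \<pi> \<i> k n\<close>, a period of \<open>exp\<close>.\<close>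

lemma modulation_int_shift:
  assumes "\<xi> \<in> \<int>"
  shows "modulation \<xi> h (x - of_int k) = exp (2 * of_real pi * \<i> * of_real x * of_real \<xi>) * h (x - of_int k)"
proof -
  from assms obtain n where n: "\<xi> = of_int n"
    by (elim Ints_cases)
  have "2 * of_real pi * \<i> * of_real (x - of_int k) * of_real \<xi>
      = 2 * of_real pi * \<i> * of_real x * of_real \<xi> + 2 * of_real pi * \<i> * of_int (- (k * n))"
    by (simp add: n algebra_simps)
  moreover have "exp (2 * of_real pi * \<i> * of_int (- (k * n))) = 1"
    unfolding exp_eq_1 by (auto intro!: exI[of _ "- (k * n)"])
  ultimately show ?thesis
    by (simp only: modulation_def exp_add) simp
qed

theorem theorem2p6:
  fixes g :: "real \<Rightarrow> complex" and \<Lambda> :: "real set"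
  assumes "g \<in> W0"
    and "dense_in_W0 (complex_fun.span (gabor_system g (uminus ` \<Lambda> \<times> \<int>)))"
  shows "\<forall>x::real. uniqueness_set ((\<lambda>l. l + x) ` \<Lambda>) (V_infty g)"
  unfolding uniqueness_set_def
proof (intro allI ballI impI)
  fix x f
  assume "f \<in> V_infty g" and vanish: "\<forall>l\<in>(\<lambda>l. l + x) ` \<Lambda>. f l = 0"
  then obtain c where c: "bounded (range c)"
    and f: "\<And>y. ((\<lambda>k. c k * g (y - of_int k)) has_sum f y) UNIV"
    by (auto simp: V_infty_def)
  from c obtain C where C: "C > 0" "\<And>k. norm (c k) \<le> C"
    by (auto simp: bounded_pos)
  have generators: "((\<lambda>k. c k * h (x - of_int k)) has_sum 0) UNIV"
    if h: "h \<in> gabor_system g (uminus ` \<Lambda> \<times> \<int>)" for h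
  proof -
    obtain l \<xi> where l: "l \<in> \<Lambda>" and \<xi>: "\<xi> \<in> \<int>" and h_eq: "h = modulation \<xi> (translation (- l) g)"
      using h by (auto simp: gabor_system_def)
    let ?e = "exp (2 * of_real pi * \<i> * of_real x * of_real \<xi>)"
    \<comment> \<open>Translation by \<open>- l\<close> turns the sampled generator into the series
      of \<open>f\<close> at \<open>l + x\<close>, up to the constant \<open>?e\<close>.\<close>
    have "((\<lambda>k. ?e * (c k * g (l + x - of_int k))) has_sum (?e * f (l + x))) UNIV"
      by (intro has_sum_cmult_right f)
    moreover have "f (l + x) = 0"
      using vanish l by blast
    ultimately show ?thesis
      by (simp add: h_eq modulation_int_shift[OF \<xi>] translation_def algebra_simps)
  qed
  have "c m = 0" for m
  proof (rule ccontr)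
    assume "c m \<noteq> 0"
    let ?t = "tent (x - of_int m)"
    \<comment> \<open>This tolerance is the one that the bound by \<open>C * W_norm\<close> turns
      into \<open>norm (c m)\<close>.\<close>
    have "norm (c m) / C > 0"
      using \<open>c m \<noteq> 0\<close> C by simp
    then obtain p where p: "p \<in> complex_fun.span (gabor_system g (uminus ` \<Lambda> \<times> \<int>))"
      and p_close: "W_norm (\<lambda>y. ?t y - p y) < norm (c m) / C"
      using assms(2) tent_in_W0 unfolding dense_in_W0_def by blast
    have "p \<in> W0"
      using p assms(2) by (auto simp: dense_in_W0_def)
    have "((\<lambda>k. c k * ?t (x - of_int k)) has_sum c m) UNIV"
      by (rule has_sum_finite_neutralI[of "{m}"]) (auto simp: tent_int_shift)
    \<comment> \<open>Subtracting \<open>p\<close> leaves the value \<open>c m\<close> unchanged,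
      because the functional kills the span.\<close>
    from has_sum_add[OF this has_sum_uminusI[OF span_annihilated[OF generators p]]]
    have "((\<lambda>k. c k * (?t (x - of_int k) - p (x - of_int k))) has_sum c m) UNIV"
      by (simp add: algebra_simps)
    then have "norm (c m) \<le> C * W_norm (\<lambda>y. ?t y - p y)"
      by (rule W_norm_lattice_bound[OF W0_diff[OF tent_in_W0 \<open>p \<in> W0\<close>] C(2)])
    also have "\<dots> < norm (c m)"
      using p_close C(1) by (simp add: pos_less_divide_eq mult.commute)
    finally show False by simp
  qed
  then have "f y = 0" for y
    using has_sum_unique[OF f[of y], of 0] by simp
  then show "f = (\<lambda>x. 0)" by auto
qed

end
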